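(* Let $n\ge 2$ and let $(x_1,y_1),\dots,(x_n,y_n)$ be real data points with $S_{xx}>0$ and $S_{yy}>0$. Let $\lambda\in[0,1]$ and consider the function $$SSE_o(\beta_0,\beta_1,\lambda)=(1-\lambda)^2 S_{yy}\,\frac{1}{\beta_1^2}\sum_{i=1}^n (y_i-\beta_0-\beta_1x_i)^2+\lambda^2 S_{xx}\sum_{i=1}^n (y_i-\beta_0-\beta_1x_i)^2$$ of $\beta_0\in\mathbb{R}$ and $\beta_1\in\mathbb{R}\setminus\{0\}$. Then: (i) for each $\beta_1\neq 0$, the solution of $\partial SSE_o/\partial\beta_0=0$ is $\beta_0=\overline{y}-\beta_1\overline{x}$, and for this value of $\beta_0$ $$SSE_o=\left(\frac{(1-\lambda)^2S_{yy}}{\beta_1^2}+\lambda^2S_{xx}\right)\left(S_{yy}-2\beta_1S_{xy}+\beta_1^2S_{xx}\right);$$ (ii) the values $\beta_1\ne 0$ at which the derivative with respect to $\beta_1$ of the expression in (i) vanishes are exactly the nonzero real roots of $$P_4(\beta_1)=\lambda^2\sqrt{\frac{S_{xx}}{S_{yy}}}\,\frac{S_{xx}}{S_{yy}}\,\beta_1^4-\lambda^2\frac{S_{xx}}{S_{yy}}\,\rho\,\beta_1^3+(1-\lambda)^2\rho\,\beta_1-(1-\lambda)^2\sqrt{\frac{S_{yy}}{S_{xx}}}.$$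
   Context: Notation: $\overline{x}=\frac1n\sum_{i=1}^n x_i$, $\overline{y}=\frac1n\sum_{i=1}^n y_i$, $S_{xx}=\sum_{i=1}^n(x_i-\overline{x})^2$, $S_{yy}=\sum_{i=1}^n(y_i-\overline{y})^2$, $S_{xy}=\sum_{i=1}^n(x_i-\overline{x})(y_i-\overline{y})$, and $\rho=S_{xy}/\sqrt{S_{xx}S_{yy}}$. The function $SSE_o$ is the standardized sum of squared oblique errors from the data to the line $y=\beta_0+\beta_1x$: a weighted combination of the sum of squared horizontal errors $\beta_1^{-2}\sum_i (y_i-\beta_0-\beta_1x_i)^2$ and the sum of squared vertical errors $\sum_i (y_i-\beta_0-\beta_1x_i)^2$. *)

theory Defs
  imports "HOL-Analysis.Analysis" "HOL-Computational_Algebra.Polynomial"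
begin

(* Data points are indexed by i in {1..n}; values x i, y i outside that range are never used. *)

definition sample_mean :: "nat \<Rightarrow> (nat \<Rightarrow> real) \<Rightarrow> real" where
  "sample_mean n u = (1 / real n) * (\<Sum>i=1..n. u i)"

(* S_xx = SS n x and S_yy = SS n y *)
definition SS :: "nat \<Rightarrow> (nat \<Rightarrow> real) \<Rightarrow> real" where
  "SS n u = (\<Sum>i=1..n. (u i - sample_mean n u)\<^sup>2)"

(* S_xy = SP n x y *)
definition SP :: "nat \<Rightarrow> (nat \<Rightarrow> real) \<Rightarrow> (nat \<Rightarrow> real) \<Rightarrow> real" where
  "SP n u v = (\<Sum>i=1..n. (u i - sample_mean n u) * (v i - sample_mean n v))"

definition corr :: "nat \<Rightarrow> (nat \<Rightarrow> real) \<Rightarrow> (nat \<Rightarrow> real) \<Rightarrow> real" where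
  "corr n x y = SP n x y / sqrt (SS n x * SS n y)"

(* Meaningful only for b1 \<noteq> 0. *)
definition SSE_o ::
  "nat \<Rightarrow> (nat \<Rightarrow> real) \<Rightarrow> (nat \<Rightarrow> real) \<Rightarrow> real \<Rightarrow> real \<Rightarrow> real \<Rightarrow> real" where
  "SSE_o n x y b0 b1 lam =
     (1 - lam)\<^sup>2 * SS n y * (1 / b1\<^sup>2) * (\<Sum>i=1..n. (y i - b0 - b1 * x i)\<^sup>2)
     + lam\<^sup>2 * SS n x * (\<Sum>i=1..n. (y i - b0 - b1 * x i)\<^sup>2)"

definition P4 :: "nat \<Rightarrow> (nat \<Rightarrow> real) \<Rightarrow> (nat \<Rightarrow> real) \<Rightarrow> real \<Rightarrow> real poly" where
  "P4 n x y lam =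
     monom (lam\<^sup>2 * sqrt (SS n x / SS n y) * (SS n x / SS n y)) 4
     - monom (lam\<^sup>2 * (SS n x / SS n y) * corr n x y) 3
     + monom ((1 - lam)\<^sup>2 * corr n x y) 1
     - monom ((1 - lam)\<^sup>2 * sqrt (SS n y / SS n x)) 0"

end

theory Submission
  imports Defs
begin

text \<open>
  Write a = Sxx, c = Syy, p = Sxy.  After centering the data at the two means, the
  residual of the i-th point splits into a centered part and a constant, and the cross terms
  vanish because centered data sum to zero.  The sum of squared residuals is therefore
  n (b0 - (ybar - b1 xbar))^2 + (c - 2 b1 p + b1^2 a)
  (lemma \<open>sum_residuals_squared\<close>).  Both horizontal and vertical errors are multiples of this
  same sum, so \<open>SSE_o\<close> is a single weight times it; the weight is strictly
  positive because \<open>lam\<close> and \<open>1 - lam\<close> cannot both vanish.  Part (i) is thus the statement about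
  the critical point of a genuine parabola in \<open>b0\<close>.

  For part (ii), the derivative of the profiled objective is the rational function
  2 / t^3 (lam^2 a^2 t^4 - lam^2 a p t^3 + (1 - lam)^2 c p t - (1 - lam)^2 c^2).
  Dividing the quartic by c sqrt (a c) > 0 normalises it to \<open>P4\<close>, so
  for \<open>t \<noteq> 0\<close> the derivative and \<open>P4\<close> differ by a nonzero factor
  (lemmas \<open>profile_has_derivative\<close> and \<open>poly_P4_scaled\<close>).
\<close>

lemma sum_centered: "(\<Sum>i=1..n. u i - sample_mean n u) = 0"
  by (simp add: sum_subtractf sample_mean_def)

text \<open>
  This is the Pythagorean decomposition of the residual vector into its components
  orthogonal and parallel to the constant vector.
\<close>
lemma sum_residuals_squared:
  "(\<Sum>i=1..n. (y i - b0 - b1 * x i)\<^sup>2) =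
     real n * (b0 - (sample_mean n y - b1 * sample_mean n x))\<^sup>2
     + (SS n y - 2 * b1 * SP n x y + b1\<^sup>2 * SS n x)"
proof -
  define d where "d = b0 - (sample_mean n y - b1 * sample_mean n x)"
  define X where "X i = x i - sample_mean n x" for i
  define Y where "Y i = y i - sample_mean n y" for i
  have sX: "(\<Sum>i=1..n. X i) = 0" and sY: "(\<Sum>i=1..n. Y i) = 0"
    unfolding X_def Y_def by (rule sum_centered)+
  have "(y i - b0 - b1 * x i)\<^sup>2
      = d\<^sup>2 + (Y i)\<^sup>2 - 2 * b1 * (X i * Y i) + b1\<^sup>2 * (X i)\<^sup>2
        + 2 * d * b1 * X i - 2 * d * Y i" for i
    unfolding d_def X_def Y_def by (simp add: power2_eq_square algebra_simps)
  then have "(\<Sum>i=1..n. (y i - b0 - b1 * x i)\<^sup>2)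
      = real n * d\<^sup>2 + (\<Sum>i=1..n. (Y i)\<^sup>2) - 2 * b1 * (\<Sum>i=1..n. X i * Y i)
        + b1\<^sup>2 * (\<Sum>i=1..n. (X i)\<^sup>2)
        + 2 * d * b1 * (\<Sum>i=1..n. X i) - 2 * d * (\<Sum>i=1..n. Y i)"
    by (simp add: sum.distrib sum_subtractf sum_distrib_left)
  then show ?thesis
    unfolding sX sY by (simp add: SS_def SP_def X_def Y_def d_def)
qed

lemma SSE_o_eq_parabola:
  "SSE_o n x y b0 b1 lam =
     ((1 - lam)\<^sup>2 * SS n y / b1\<^sup>2 + lam\<^sup>2 * SS n x) *
     (real n * (b0 - (sample_mean n y - b1 * sample_mean n x))\<^sup>2
      + (SS n y - 2 * b1 * SP n x y + b1\<^sup>2 * SS n x))"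
  unfolding SSE_o_def sum_residuals_squared by (simp add: distrib_right)

lemma weight_pos:
  fixes a b c lam :: real
  assumes "a > 0" "c > 0" "b \<noteq> 0"
  shows "(1 - lam)\<^sup>2 * c / b\<^sup>2 + lam\<^sup>2 * a > 0"
proof (cases "lam = 0")
  case True
  then show ?thesis using assms by simp
next
  case False
  have "(1 - lam)\<^sup>2 * c / b\<^sup>2 \<ge> 0" using assms by simp
  moreover have "lam\<^sup>2 * a > 0" using False assms by simp
  ultimately show ?thesis by linarith
qed

lemma parabola_critical_point_iff:
  fixes W k m s b :: real
  assumes "W > 0" "k > 0"
  shows "((\<lambda>t. W * (k * (t - m)\<^sup>2 + s)) has_real_derivative 0) (at b) \<longleftrightarrow> b = m"
proof -
  have D: "((\<lambda>t. W * (k * (t - m)\<^sup>2 + s)) has_real_derivative 2 * W * k * (b - m)) (at b)"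
    by (auto intro!: derivative_eq_intros)
  have "((\<lambda>t. W * (k * (t - m)\<^sup>2 + s)) has_real_derivative 0) (at b)
      \<longleftrightarrow> 2 * W * k * (b - m) = 0"
    using D DERIV_unique by metis
  then show ?thesis using assms by simp
qed

lemma profile_has_derivative:
  fixes A B a c p t :: real
  assumes "t \<noteq> 0"
  shows "((\<lambda>t. (A / t\<^sup>2 + B) * (c - 2 * t * p + t\<^sup>2 * a)) has_real_derivative
           2 / t ^ 3 * (B * a * t ^ 4 - B * p * t ^ 3 + A * p * t - A * c)) (at t)"
proof -
  have W: "((\<lambda>t. A / t\<^sup>2 + B) has_real_derivative - 2 * A / t ^ 3) (at t)"
    using assms
    by (intro derivative_eq_intros refl)
       (simp_all add: power2_eq_square power3_eq_cube, simp add: field_simps)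
  have Q: "((\<lambda>t. c - 2 * t * p + t\<^sup>2 * a) has_real_derivative 2 * t * a - 2 * p) (at t)"
    by (auto intro!: derivative_eq_intros)
  have "((\<lambda>t. (A / t\<^sup>2 + B) * (c - 2 * t * p + t\<^sup>2 * a)) has_real_derivative
           (- 2 * A / t ^ 3) * (c - 2 * t * p + t\<^sup>2 * a)
           + (A / t\<^sup>2 + B) * (2 * t * a - 2 * p)) (at t)"
    using DERIV_mult[OF W Q] by (simp add: ac_simps)
  moreover have "(- 2 * A / t ^ 3) * (c - 2 * t * p + t\<^sup>2 * a)
           + (A / t\<^sup>2 + B) * (2 * t * a - 2 * p)
        = 2 / t ^ 3 * (B * a * t ^ 4 - B * p * t ^ 3 + A * p * t - A * c)"
    using assms by (simp add: field_simps power2_eq_square power3_eq_cube power4_eq_xxxx)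
  ultimately show ?thesis by simp
qed

text \<open>
  \<open>P4\<close> is written in terms of the ratio Sxx / Syy and the correlation, whose denominators
  the factor c sqrt (a c) clears.
\<close>
lemma poly_P4_scaled:
  assumes "SS n x > 0" "SS n y > 0"
  shows "SS n y * sqrt (SS n x * SS n y) * poly (P4 n x y lam) t =
           lam\<^sup>2 * SS n x * SS n x * t ^ 4 - lam\<^sup>2 * SS n x * SP n x y * t ^ 3
           + (1 - lam)\<^sup>2 * SS n y * SP n x y * t - (1 - lam)\<^sup>2 * SS n y * SS n y"
proof -
  define r s where "r = sqrt (SS n x)" and "s = sqrt (SS n y)"
  have rs: "r > 0" "s > 0" "SS n x = r * r" "SS n y = s * s"
    using assms by (simp_all add: r_def s_def)
  show ?thesis
    unfolding P4_def corr_def rs(3,4) using rs(1,2)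
    by (simp add: poly_monom real_sqrt_mult real_sqrt_divide field_simps)
qed

theorem mainTheorem1:
  fixes n :: nat and x y :: "nat \<Rightarrow> real" and lam :: real
  assumes "n \<ge> 2"
    and "SS n x > 0"
    and "SS n y > 0"
    and "0 \<le> lam" and "lam \<le> 1"
  shows
    "(\<forall>b1. b1 \<noteq> 0 \<longrightarrow>
        (\<forall>b0. ((\<lambda>t. SSE_o n x y t b1 lam) has_real_derivative 0) (at b0)
               \<longleftrightarrow> b0 = sample_mean n y - b1 * sample_mean n x)
        \<and> SSE_o n x y (sample_mean n y - b1 * sample_mean n x) b1 lam
            = ((1 - lam)\<^sup>2 * SS n y / b1\<^sup>2 + lam\<^sup>2 * SS n x)
              * (SS n y - 2 * b1 * SP n x y + b1\<^sup>2 * SS n x))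
     \<and> {b1. b1 \<noteq> 0 \<and>
            ((\<lambda>t. ((1 - lam)\<^sup>2 * SS n y / t\<^sup>2 + lam\<^sup>2 * SS n x)
                  * (SS n y - 2 * t * SP n x y + t\<^sup>2 * SS n x))
               has_real_derivative 0) (at b1)}
       = {b1. b1 \<noteq> 0 \<and> poly (P4 n x y lam) b1 = 0}"
proof (intro conjI allI impI)
  fix b0 b1 :: real
  assume "b1 \<noteq> 0"
  then show "((\<lambda>t. SSE_o n x y t b1 lam) has_real_derivative 0) (at b0)
      \<longleftrightarrow> b0 = sample_mean n y - b1 * sample_mean n x"
    unfolding SSE_o_eq_parabola
    using assms by (intro parabola_critical_point_iff weight_pos) auto
next
  fix b1 :: real
  show "SSE_o n x y (sample_mean n y - b1 * sample_mean n x) b1 lam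
      = ((1 - lam)\<^sup>2 * SS n y / b1\<^sup>2 + lam\<^sup>2 * SS n x)
        * (SS n y - 2 * b1 * SP n x y + b1\<^sup>2 * SS n x)"
    by (simp add: SSE_o_eq_parabola)
next
  let ?f = "\<lambda>t. ((1 - lam)\<^sup>2 * SS n y / t\<^sup>2 + lam\<^sup>2 * SS n x)
                  * (SS n y - 2 * t * SP n x y + t\<^sup>2 * SS n x)"
  have "(?f has_real_derivative 0) (at b) \<longleftrightarrow> poly (P4 n x y lam) b = 0" if "b \<noteq> 0" for b
  proof -
    let ?D = "2 / b ^ 3 * (SS n y * sqrt (SS n x * SS n y) * poly (P4 n x y lam) b)"
    have "(?f has_real_derivative ?D) (at b)"
      unfolding poly_P4_scaled[OF assms(2,3)] by (rule profile_has_derivative[OF that])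
    then have "(?f has_real_derivative 0) (at b) \<longleftrightarrow> ?D = 0"
      by (auto dest: DERIV_unique)
    then show ?thesis using that assms(2,3) by simp
  qed
  then show "{b1. b1 \<noteq> 0 \<and> (?f has_real_derivative 0) (at b1)}
      = {b1. b1 \<noteq> 0 \<and> poly (P4 n x y lam) b1 = 0}"
    by blast
qed

end
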